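(* Let $\tilde{\mathcal H}:T^*\mathcal Y\to\mathbb R$, $\mathcal Y=T^*\mathcal Q$, be $$\tilde{\mathcal H}(q,\lambda,p_q,p_\lambda)=-p_\lambda^\top p_q+\lambda^\top\tilde f(q,p_\lambda)+\tfrac12\,b(q)(\lambda,\lambda),$$ with $\tilde f(q,p_\lambda)=f(q,-p_\lambda)$ and $\tilde\phi(q,p_\lambda)=\phi(q,-p_\lambda)$. Hamilton's equations $\dot y=\partial_{p_y}\tilde{\mathcal H}$, $\dot p_y=-\partial_y\tilde{\mathcal H}$ in the variables $y=(q,\lambda)$, $p_y=(p_q,p_\lambda)$ are $$\dot q=-p_\lambda,\qquad \dot\lambda=-p_q+\tfrac{\partial}{\partial p_\lambda}\tilde f(q,p_\lambda)^\top\lambda,$$ $$\dot p_q=-\tfrac{\partial}{\partial q}\tilde f(q,p_\lambda)^\top\lambda-\tfrac12\Big(\tfrac{\partial}{\partial q}\big(b(q)(\lambda,\lambda)\big)\Big)^\top,\qquad \dot p_\lambda=-\tilde f(q,p_\lambda)-b(q)\lambda ,$$ and they are equivalent to the Euler-Lagrange equations $$\ddot q=f(q,\dot q)+b(q)\lambda,\qquad \ddot\lambda=\tfrac12\Big(\tfrac{\partial}{\partial q}\big(b(q)(\lambda,\lambda)\big)\Big)^\top+\Big(\tfrac{\partial}{\partial q}f(q,\dot q)\Big)^\top\lambda-\frac{d}{dt}\Big(\tfrac{\partial}{\partial\dot q}f(q,\dot q)^\top\lambda\Big)$$ of $\tilde{\mathcal L}$; that is, for $(q,\lambda)\in C^3([0,T],T^*\mathcal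 Q)$, $(q,\lambda)$ solves the Euler-Lagrange equations if and only if $(q,\lambda,p_q,p_\lambda)$ solves Hamilton's equations for some $p_q,p_\lambda$, and then $p_q,p_\lambda$ are given by the Legendre transformation $p_q=-\dot\lambda-\frac{\partial}{\partial\dot q}f(q,\dot q)^\top\lambda$, $p_\lambda=-\dot q$. Moreover, for such a solution that satisfies the terminal conditions $\dot\lambda(T)+\frac{\partial}{\partial\dot q}f(q(T),\dot q(T))^\top\lambda(T)=\frac{\partial}{\partial q}\phi(q(T),\dot q(T))^\top$ and $\lambda(T)=-\frac{\partial}{\partial\dot q}\phi(q(T),\dot q(T))^\top$, one has the boundary conditions $$\dot q(0)=-p_\lambda(0),\qquad \dot\lambda(0)=-p_q(0)+\tfrac{\partial}{\partial p_\lambda}\tilde f(q(0),p_\lambda(0))^\top\lambda(0),$$ $$\dot q(T)=-p_\lambda(T),\qquad \dot\lambda(T)=-p_q(T)+\tfrac{\partial}{\partial p_\lambda}\tilde f(q(T),p_\lambda(T))^\top\lambda(T),$$ $$p_q(T)=-\tfrac{\partial}{\partial q}\tilde\phi(q(T),p_\lambda(T))^\top,\qquad \lambda(T)=\tfrac{\partial}{\partial p_\lambda}\tilde\phi(q(T),p_\lambda(T))^\top .$$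
   Context: Setting. All formulas are in local coordinates; $\mathcal Q$ is identified with an open subset of $\mathbb R^d$, so $T\mathcal Q=\mathcal Q\times\mathbb R^d$ and $T^*\mathcal Q=\mathcal Q\times\mathbb R^d$. Data: $T>0$ fixed; a drift $f:T\mathcal Q\to\mathbb R^d$; a matrix function $\rho:\mathcal Q\to\mathbb R^{d\times m}$ ($m\le d$) with $\rho(q)$ injective for all $q$; a Riemannian metric $\mathrm g_{\mathcal Q}$ on $\mathcal Q$, and $\mathrm g(q)=\rho(q)^\top\mathrm g_{\mathcal Q}(q)\rho(q)\in\mathbb R^{m\times m}$ (symmetric positive definite); a terminal cost $\phi:T\mathcal Q\to\mathbb R$. The maps $f,\rho,\mathrm g,\phi$ are $C^1$. Put $b(q)=\rho(q)\mathrm g(q)^{-1}\rho(q)^\top$ and $b(q)(\lambda,\lambda)=\lambda^\top b(q)\lambda$. Derivatives with respect to $\dot q$ are with respect to the second argument of $f$ or $\phi$. Whenever $\frac{d}{dt}(\cdot)$ of an expression occurs in an equation, the equation includes the assertion that this derivative exists. The Lagrangian is $\tilde{\mathcal L}(q,\lambda,\dot q,\dot\lambda)=-\dot\lambda^\top\dot q-\lambda^\top f(q,\dot q)-\frac12 b(q)(\lambda,\lambda)$ on $T\mathcal Y$. Its Legendre transformation $p_y=\partial\tilde{\mathcal L}/\partial\dot y$ is $p_q=-\dot\lambda-\frac{\partial}{\partial\dot q}f(q,\dot q)^\top\lambda$, $p_\lambda=-\dot q$, which is invertible, and $\tilde{\mathcal H}=p_q^\top\dot q+p_\lambda^\top\dot\lambda-\tilde{\mathcal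 L}$ expressed in $(q,\lambda,p_q,p_\lambda)$. (The problem originates from minimising $\phi(q(T),\dot q(T))+\int_0^T\frac12 u^\top\mathrm g(q)u\,dt$ subject to $\ddot q=f(q,\dot q)+\rho(q)u$ with $q(0),\dot q(0)$ fixed; the terminal conditions in the claim are its transversality conditions.) *)

theory Defs
  imports "HOL-Analysis.Analysis"
begin

text \<open>\<open>grad h x\<close> is the transposed derivative row vector of a differentiable function; it is
  unspecified where \<open>h\<close> is not differentiable.\<close>

definition grad :: "('a::real_inner \<Rightarrow> real) \<Rightarrow> 'a \<Rightarrow> 'a" where
  "grad h x = (THE D. GDERIV h x :> D)"

definition C1_on :: "'a::real_normed_vector set \<Rightarrow> ('a \<Rightarrow> 'b::real_normed_vector) \<Rightarrow> bool" where
  "C1_on S F \<longleftrightarrow>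
     (\<exists>F' :: 'a \<Rightarrow> 'a \<Rightarrow>\<^sub>L 'b. (\<forall>x\<in>S. (F has_derivative blinfun_apply (F' x)) (at x))
        \<and> continuous_on S F')"

text \<open>Curves of class \<open>C\<^sup>k\<close> on a nondegenerate compact interval, with one-sided derivatives at its
  endpoints.\<close>

primrec Ck_curve :: "nat \<Rightarrow> real set \<Rightarrow> (real \<Rightarrow> 'a::real_normed_vector) \<Rightarrow> bool" where
  "Ck_curve 0 I x \<longleftrightarrow> continuous_on I x"
| "Ck_curve (Suc k) I x \<longleftrightarrow>
     (\<exists>x'. (\<forall>t\<in>I. (x has_vector_derivative x' t) (at t within I)) \<and> Ck_curve k I x')"

definition cotangent_curve ::
    "nat \<Rightarrow> real set \<Rightarrow> 'a::real_normed_vector set \<Rightarrow> (real \<Rightarrow> 'a) \<Rightarrow> (real \<Rightarrow> 'a) \<Rightarrow> bool" where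
  "cotangent_curve k I Q q l \<longleftrightarrow> Ck_curve k I (\<lambda>t. (q t, l t)) \<and> (\<forall>t\<in>I. (q t, l t) \<in> Q \<times> UNIV)"

definition vel :: "real set \<Rightarrow> (real \<Rightarrow> 'a::real_normed_vector) \<Rightarrow> real \<Rightarrow> 'a" where
  "vel I x t = vector_derivative x (at t within I)"

definition euler_lagrange ::
    "('a::real_inner \<Rightarrow> 'a \<Rightarrow> real) \<Rightarrow> real set \<Rightarrow> (real \<Rightarrow> 'a) \<Rightarrow> bool" where
  "euler_lagrange L I y \<longleftrightarrow>
     (\<forall>t\<in>I. (y has_vector_derivative vel I y t) (at t within I) \<and>
        ((\<lambda>s. grad (\<lambda>w. L (y s) w) (vel I y s)) has_vector_derivative
           grad (\<lambda>x. L x (vel I y t)) (y t)) (at t within I))"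

definition hamilton ::
    "('a::real_inner \<Rightarrow> 'a \<Rightarrow> real) \<Rightarrow> real set \<Rightarrow> (real \<Rightarrow> 'a) \<Rightarrow> (real \<Rightarrow> 'a) \<Rightarrow> bool" where
  "hamilton H I y p \<longleftrightarrow>
     (\<forall>t\<in>I. (y has_vector_derivative grad (\<lambda>w. H (y t) w) (p t)) (at t within I) \<and>
        (p has_vector_derivative - grad (\<lambda>x. H x (p t)) (y t)) (at t within I))"

definition legendre :: "('a::real_inner \<Rightarrow> 'a \<Rightarrow> real) \<Rightarrow> 'a \<Rightarrow> 'a \<Rightarrow> 'a" where
  "legendre L y w = grad (\<lambda>w'. L y w') w"

text \<open>A metric tensor as a field of Gram matrices. No regularity in \<open>q\<close> is included: it is only
  needed for the induced matrix \<open>\<rho>\<^sup>T g\<^sub>Q \<rho>\<close>, where it is assumed separately.\<close>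

definition metric_on :: "(real^'d) set \<Rightarrow> (real^'d \<Rightarrow> real^'d^'d) \<Rightarrow> bool" where
  "metric_on Q gQ \<longleftrightarrow>
     (\<forall>q\<in>Q. transpose (gQ q) = gQ q \<and> (\<forall>v. v \<noteq> 0 \<longrightarrow> v \<bullet> (gQ q *v v) > 0))"

definition induced_metric ::
    "(real^'d \<Rightarrow> real^'m^'d) \<Rightarrow> (real^'d \<Rightarrow> real^'d^'d) \<Rightarrow> real^'d \<Rightarrow> real^'m^'m" where
  "induced_metric \<rho> gQ q = transpose (\<rho> q) ** gQ q ** \<rho> q"

definition control_form ::
    "(real^'d \<Rightarrow> real^'m^'d) \<Rightarrow> (real^'d \<Rightarrow> real^'d^'d) \<Rightarrow> real^'d \<Rightarrow> real^'d^'d" where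
  "control_form \<rho> gQ q = \<rho> q ** matrix_inv (induced_metric \<rho> gQ q) ** transpose (\<rho> q)"

definition quad :: "real^'d^'d \<Rightarrow> real^'d \<Rightarrow> real" where
  "quad B l = l \<bullet> (B *v l)"

text \<open>In the Lagrangian the second argument is \<open>(q', \<lambda>')\<close>, in the Hamiltonian it is \<open>(p\<^sub>q, p\<^sub>\<lambda>)\<close>.
  Both are total functions, meaningful for \<open>q \<in> Q\<close>.\<close>

definition lagrangian ::
    "(real^'d \<Rightarrow> real^'d \<Rightarrow> real^'d) \<Rightarrow> (real^'d \<Rightarrow> real^'d^'d)
      \<Rightarrow> (real^'d) \<times> (real^'d) \<Rightarrow> (real^'d) \<times> (real^'d) \<Rightarrow> real" where
  "lagrangian f b = (\<lambda>(q, l) (v, w). - (w \<bullet> v) - l \<bullet> f q v - 1/2 * quad (b q) l)"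

text \<open>The reparametrisation \<open>v = -p\<^sub>\<lambda>\<close> of the velocity argument.\<close>

definition tilde :: "('a \<Rightarrow> 'b::uminus \<Rightarrow> 'c) \<Rightarrow> 'a \<Rightarrow> 'b \<Rightarrow> 'c" where
  "tilde F q p = F q (- p)"

definition hamiltonian ::
    "(real^'d \<Rightarrow> real^'d \<Rightarrow> real^'d) \<Rightarrow> (real^'d \<Rightarrow> real^'d^'d)
      \<Rightarrow> (real^'d) \<times> (real^'d) \<Rightarrow> (real^'d) \<times> (real^'d) \<Rightarrow> real" where
  "hamiltonian f b = (\<lambda>(q, l) (pq, pl). - (pl \<bullet> pq) + l \<bullet> tilde f q pl + 1/2 * quad (b q) l)"

definition hamilton_system ::
    "(real^'d \<Rightarrow> real^'d \<Rightarrow> real^'d) \<Rightarrow> (real^'d \<Rightarrow> real^'d^'d) \<Rightarrow> real set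
      \<Rightarrow> (real \<Rightarrow> real^'d) \<Rightarrow> (real \<Rightarrow> real^'d) \<Rightarrow> (real \<Rightarrow> real^'d) \<Rightarrow> (real \<Rightarrow> real^'d) \<Rightarrow> bool" where
  "hamilton_system f b I q l pq pl \<longleftrightarrow>
     (\<forall>t\<in>I.
        (q has_vector_derivative - pl t) (at t within I) \<and>
        (l has_vector_derivative
           - pq t + transpose (jacobian (\<lambda>p. tilde f (q t) p) (at (pl t))) *v l t) (at t within I) \<and>
        (pq has_vector_derivative
           - (transpose (jacobian (\<lambda>x. tilde f x (pl t)) (at (q t))) *v l t)
           - (1/2) *\<^sub>R grad (\<lambda>x. quad (b x) (l t)) (q t)) (at t within I) \<and>
        (pl has_vector_derivative - tilde f (q t) (pl t) - b (q t) *v l t) (at t within I))"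

definition euler_lagrange_system ::
    "(real^'d \<Rightarrow> real^'d \<Rightarrow> real^'d) \<Rightarrow> (real^'d \<Rightarrow> real^'d^'d) \<Rightarrow> real set
      \<Rightarrow> (real \<Rightarrow> real^'d) \<Rightarrow> (real \<Rightarrow> real^'d) \<Rightarrow> bool" where
  "euler_lagrange_system f b I q l \<longleftrightarrow>
     (\<forall>t\<in>I.
        (q has_vector_derivative vel I q t) (at t within I) \<and>
        (l has_vector_derivative vel I l t) (at t within I) \<and>
        (vel I q has_vector_derivative f (q t) (vel I q t) + b (q t) *v l t) (at t within I) \<and>
        (\<exists>D. ((\<lambda>s. transpose (jacobian (\<lambda>v. f (q s) v) (at (vel I q s))) *v l s)
                has_vector_derivative D) (at t within I) \<and>
             (vel I l has_vector_derivative
                (1/2) *\<^sub>R grad (\<lambda>x. quad (b x) (l t)) (q t)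
                + transpose (jacobian (\<lambda>x. f x (vel I q t)) (at (q t))) *v l t
                - D) (at t within I)))"

end

theory Submission
  imports Defs
begin

text \<open>The momentum \<open>legendre L y y'\<close> is affine in \<open>\<lambda>'\<close> and \<open>p\<^sub>\<lambda> = -q'\<close>, so the Legendre
  transformation is inverted by hand and Hamilton's first pair of equations is its inverse. The
  second pair then is the Euler-Lagrange system with \<open>d/dt (p\<^sub>q + \<lambda>')\<close> in place of
  \<open>- d/dt (\<partial>f/\<partial>q'\<^sup>T \<lambda>)\<close>; splitting this derivative is legitimate because a \<open>C\<^sup>3\<close> curve has a
  second derivative \<open>\<lambda>''\<close>. The gradients in \<open>q\<close> require \<open>b = \<rho> g\<^sup>-\<^sup>1 \<rho>\<^sup>T\<close> to be differentiable and
  symmetric; differentiability of the inverse comes from Cramer's rule.\<close>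

section \<open>Gradients as representing vectors of derivatives\<close>

text \<open>A vector is determined by its inner products with all vectors, so uniqueness of the
  derivative functional resolves the definite description in \<open>grad\<close>.\<close>

lemma grad_eqI: "GDERIV h x :> D \<Longrightarrow> grad h x = D"
proof -
  assume h: "GDERIV h x :> D"
  have "E = D" if "GDERIV h x :> E" for E
    using has_derivative_unique[OF that[unfolded gderiv_def] h[unfolded gderiv_def]]
    by (metis inner_commute vector_eq_rdot)
  with h show ?thesis
    unfolding grad_def by (rule the_equality)
qed

text \<open>Riesz representation in finite dimension: a linear functional \<open>h'\<close> is the
  inner product with \<open>adjoint h' 1\<close>.\<close>

lemma GDERIV_grad:
  fixes h :: "'a::euclidean_space \<Rightarrow> real"
  assumes "h differentiable (at x)"
  shows "GDERIV h x :> grad h x"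
proof -
  obtain h' where h': "(h has_derivative h') (at x)"
    using assms by (auto simp: differentiable_def)
  have "h' = (\<lambda>k. k \<bullet> adjoint h' 1)"
    using adjoint_works[OF has_derivative_linear[OF h'], of _ 1] by auto
  with h' have "GDERIV h x :> adjoint h' 1"
    by (simp add: gderiv_def)
  with grad_eqI[OF this] show ?thesis by simp
qed

text \<open>The chain rule gives \<open>l \<bullet> (J *v h)\<close>, and moving the Jacobian
  \<open>J\<close> to the other factor produces the transposed Jacobian. This is the source of every
  term of this shape in both systems.\<close>

lemma GDERIV_inner_const:
  fixes F :: "real^'n \<Rightarrow> real^'k"
  assumes "F differentiable (at x)"
  shows "GDERIV (\<lambda>x. l \<bullet> F x) x :> transpose (jacobian F (at x)) *v l"
  unfolding gderiv_def
proof (rule has_derivative_eq_rhs)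
  have "(F has_derivative (*v) (jacobian F (at x))) (at x)"
    using assms by (simp add: jacobian_works)
  then show "((\<lambda>x. l \<bullet> F x) has_derivative (\<lambda>h. l \<bullet> (jacobian F (at x) *v h))) (at x)"
    by (rule has_derivative_inner_right)
  show "(\<lambda>h. l \<bullet> (jacobian F (at x) *v h)) = (\<lambda>h. h \<bullet> (transpose (jacobian F (at x)) *v l))"
    by (metis dot_lmul_matrix inner_commute transpose_matrix_vector)
qed

section \<open>Differentiability of matrix-valued maps and of the inverse\<close>

lemma bounded_bilinear_matrix_vector_mult:
  "bounded_bilinear ((*v) :: real^'n^'k \<Rightarrow> real^'n \<Rightarrow> real^'k)"
  by (rule bilinear_conv_bounded_bilinear[THEN iffD1])
     (auto simp: bilinear_def linear_iff algebra_simps matrix_vector_mult_add_rdistrib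
       scaleR_matrix_vector_assoc matrix_vector_mult_scaleR)

lemma bounded_bilinear_matrix_matrix_mult:
  "bounded_bilinear ((**) :: real^'n^'k \<Rightarrow> real^'p^'n \<Rightarrow> real^'p^'k)"
  by (rule bilinear_conv_bounded_bilinear[THEN iffD1])
     (auto simp: bilinear_def linear_iff matrix_matrix_mult_def vec_eq_iff
       sum.distrib sum_distrib_left algebra_simps)

lemma differentiable_transpose:
  fixes M :: "'a::real_normed_vector \<Rightarrow> real^'n^'k"
  assumes "M differentiable (at x)"
  shows "(\<lambda>x. transpose (M x)) differentiable (at x)"
proof -
  have "bounded_linear (transpose :: real^'n^'k \<Rightarrow> _)"
    by (auto simp: linear_iff transpose_def vec_eq_iff simp flip: linear_conv_bounded_linear)
  then show ?thesis
    using assms bounded_linear.has_derivative unfolding differentiable_def by blast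
qed

text \<open>A vector is the sum of its components embedded along the axes, and each embedding
  \<open>axis i\<close> is bounded linear.\<close>

lemma differentiable_vec_componentwise:
  fixes F :: "'a::real_normed_vector \<Rightarrow> 'b::euclidean_space^'n"
  assumes "\<And>i. (\<lambda>x. F x $ i) differentiable (at x)"
  shows "F differentiable (at x)"
proof -
  have "bounded_linear (axis i :: 'b \<Rightarrow> 'b^'n)" for i
    by (auto simp: linear_iff axis_def vec_eq_iff simp flip: linear_conv_bounded_linear)
  then have "(\<lambda>x. axis i (F x $ i)) differentiable (at x)" for i
    using assms[of i] bounded_linear.has_derivative unfolding differentiable_def by blast
  then have "(\<lambda>x. \<Sum>i\<in>UNIV. axis i (F x $ i)) differentiable (at x)"
    by (intro differentiable_sum) auto
  moreover have "(\<Sum>i\<in>UNIV. axis i (F x $ i)) = F x" for x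
    by (simp add: vec_eq_iff axis_def)
  ultimately show ?thesis by simp
qed

lemma differentiable_vec_nth:
  fixes F :: "'a::real_normed_vector \<Rightarrow> 'b::real_normed_vector^'n"
  assumes "F differentiable (at x)"
  shows "(\<lambda>x. F x $ i) differentiable (at x)"
  using assms bounded_linear.has_derivative[OF bounded_linear_vec_nth]
  unfolding differentiable_def by blast

text \<open>By the Leibniz formula the determinant is a polynomial in the entries.\<close>

lemma differentiable_det:
  fixes M :: "'a::real_normed_vector \<Rightarrow> real^'n^'n"
  assumes "\<And>i j. (\<lambda>x. M x $ i $ j) differentiable (at x)"
  shows "(\<lambda>x. det (M x)) differentiable (at x)"
proof -
  obtain M' where M': "((\<lambda>x. M x $ i $ j) has_derivative M' i j) (at x)" for i j
    using assms unfolding differentiable_def by metis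
  have "(\<lambda>x. \<Prod>i\<in>UNIV. M x $ i $ p i) differentiable (at x)" for p
    unfolding differentiable_def
    by (rule exI, rule has_derivative_prod[where f' = "\<lambda>i. M' i (p i)"], rule M')
  then show ?thesis
    unfolding det_def
    by (intro differentiable_sum differentiable_mult differentiable_const ballI)
      (simp_all add: finite_permutations)
qed

text \<open>\<open>matrix_inv\<close> is a Hilbert choice; invertibility guarantees that the chosen
  matrix is an inverse.\<close>

lemma matrix_inv_right:
  fixes A :: "'a::semiring_1^'n^'k"
  assumes "invertible A"
  shows "A ** matrix_inv A = mat 1"
  using someI_ex[OF assms[unfolded invertible_def]] by (simp add: matrix_inv_def)

text \<open>Column \<open>j\<close> of the inverse solves the linear system with right-hand side
  \<open>axis j 1\<close>, to which Cramer's rule applies.\<close>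

lemma matrix_inv_cramer:
  fixes A :: "real^'n^'n"
  assumes "det A \<noteq> 0"
  shows "matrix_inv A $ k $ j =
    det (\<chi> i i'. if i' = k then axis j 1 $ i else A $ i $ i') / det A"
proof -
  have "A ** matrix_inv A = mat 1"
    using assms by (simp add: invertible_det_nz matrix_inv_right)
  then have "A *v (matrix_inv A *v axis j 1) = axis j 1"
    by (simp add: matrix_vector_mul_assoc)
  then have "matrix_inv A *v axis j 1 =
      (\<chi> k. det (\<chi> i i'. if i' = k then axis j 1 $ i else A $ i $ i') / det A)"
    using cramer[OF assms] by blast
  then show ?thesis
    by (metis (no_types, lifting) column_def matrix_vector_mul_component matrix_vector_mult_basis vec_lambda_beta)
qed

text \<open>Each entry of the inverse is a quotient of two determinants, and the denominator does
  not vanish at \<open>x\<close>.\<close>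

lemma differentiable_matrix_inv:
  fixes M :: "'a::real_normed_vector \<Rightarrow> real^'n^'n"
  assumes M: "M differentiable (at x)" and inv: "invertible (M x)"
  shows "(\<lambda>x. matrix_inv (M x)) differentiable (at x)"
proof (intro differentiable_vec_componentwise)
  fix k j
  have nz: "det (M x) \<noteq> 0"
    using inv by (simp add: invertible_det_nz)
  have entry: "(\<lambda>x. M x $ i $ i') differentiable (at x)" for i i'
    by (intro differentiable_vec_nth M)
  have det_M: "(\<lambda>x. det (M x)) differentiable (at x)"
    using entry by (rule differentiable_det)
  have "(\<lambda>x. (if i' = k then axis j 1 $ i else M x $ i $ i')) differentiable (at x)" for i i'
    using entry by (cases "i' = k") auto
  then have "(\<lambda>x. det (\<chi> i i'. if i' = k then axis j 1 $ i else M x $ i $ i') / det (M x))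
      differentiable (at x)"
    using det_M nz by (intro differentiable_divide differentiable_det) (auto simp: entry)
  then obtain d where "((\<lambda>x. det (\<chi> i i'. if i' = k then axis j 1 $ i else M x $ i $ i') / det (M x))
      has_derivative d) (at x)"
    by (auto simp: differentiable_def)
  \<comment> \<open>Cramer's formula describes \<open>matrix_inv\<close> only at invertible
    matrices. Continuity of the determinant keeps \<open>M y\<close> invertible for \<open>y\<close>
    near \<open>x\<close>, so the formula holds in a neighbourhood and its derivative carries
    over.\<close>
  moreover have "\<forall>\<^sub>F y in at x. det (M y) \<noteq> 0"
    using differentiable_imp_continuous_within[OF det_M] nz
    by (auto simp: continuous_within intro: tendsto_imp_eventually_ne)
  then have "\<forall>\<^sub>F y in at x.
      det (\<chi> i i'. if i' = k then axis j 1 $ i else M y $ i $ i') / det (M y) = matrix_inv (M y) $ k $ j"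
    by eventually_elim (simp add: matrix_inv_cramer)
  ultimately have "((\<lambda>x. matrix_inv (M x) $ k $ j) has_derivative d) (at x)"
    by (rule has_derivative_transform_eventually) (simp_all add: matrix_inv_cramer[OF nz])
  then show "(\<lambda>x. matrix_inv (M x) $ k $ j) differentiable (at x)"
    by (auto simp: differentiable_def)
qed

section \<open>Symmetry, invertibility and regularity of the induced metric and the control
  form\<close>

text \<open>Transposing \<open>A ** matrix_inv A = mat 1\<close> makes
  \<open>transpose (matrix_inv A)\<close> a left inverse of \<open>A\<close>, and the inverse of a
  square matrix is unique.\<close>

lemma symmetric_matrix_inv:
  fixes A :: "real^'n^'n"
  assumes "invertible A" and "transpose A = A"
  shows "transpose (matrix_inv A) = matrix_inv A"
  by (metis assms matrix_inv_right matrix_left_right_inverse matrix_mul_assoc matrix_mul_lid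
      matrix_mul_rid matrix_transpose_mul transpose_mat)

lemma induced_metric_symmetric:
  assumes "transpose (gQ q) = gQ q"
  shows "transpose (induced_metric \<rho> gQ q) = induced_metric \<rho> gQ q"
  unfolding induced_metric_def by (simp add: assms matrix_transpose_mul matrix_mul_assoc)

text \<open>If \<open>u\<close> lies in the kernel, then \<open>\<rho> q *v u\<close> has length
  zero in the metric \<open>gQ q\<close>. Positivity gives \<open>\<rho> q *v u = 0\<close>, and
  injectivity gives \<open>u = 0\<close>.\<close>

lemma invertible_induced_metric:
  fixes \<rho> :: "real^'d \<Rightarrow> real^'m^'d"
  assumes pos: "\<And>v. v \<noteq> 0 \<Longrightarrow> v \<bullet> (gQ q *v v) > 0" and inj: "inj (\<lambda>u. \<rho> q *v u)"
  shows "invertible (induced_metric \<rho> gQ q)"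
proof -
  have "u = 0" if "induced_metric \<rho> gQ q *v u = 0" for u
  proof -
    have "(\<rho> q *v u) \<bullet> (gQ q *v (\<rho> q *v u)) = u \<bullet> (induced_metric \<rho> gQ q *v u)"
      unfolding induced_metric_def
      by (simp add: dot_lmul_matrix inner_commute[of u] flip: matrix_vector_mul_assoc)
        (simp add: inner_commute)
    then have "\<rho> q *v u = 0"
      using pos that by fastforce
    then show ?thesis
      using injD[OF inj, of u 0] by simp
  qed
  then show ?thesis
    by (meson invertible_left_inverse matrix_left_invertible_ker)
qed

text \<open>Symmetry passes from \<open>gQ q\<close> to the induced metric, then to its inverse, and
  survives the congruence by \<open>\<rho> q\<close>. It is needed to differentiate the quadratic
  form in its vector argument.\<close>

lemma control_form_symmetric:
  assumes "transpose (gQ q) = gQ q" and "invertible (induced_metric \<rho> gQ q)"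
  shows "transpose (control_form \<rho> gQ q) = control_form \<rho> gQ q"
  unfolding control_form_def
  using symmetric_matrix_inv[OF assms(2) induced_metric_symmetric] assms(1)
  by (simp add: matrix_transpose_mul matrix_mul_assoc)

lemma C1_on_differentiable: "C1_on S F \<Longrightarrow> x \<in> S \<Longrightarrow> F differentiable (at x)"
  by (auto simp: C1_on_def differentiable_def)

lemma differentiable_section_left:
  assumes "(\<lambda>(x, y). F x y) differentiable (at (x, y))"
  shows "(\<lambda>x. F x y) differentiable (at x)"
  using differentiable_compose[of "\<lambda>(x, y). F x y" "\<lambda>x. (x, y)" x UNIV] assms
  by (auto intro: differentiable_at_withinI)

lemma differentiable_section_right:
  assumes "(\<lambda>(x, y). F x y) differentiable (at (x, y))"
  shows "(\<lambda>y. F x y) differentiable (at y)"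
  using differentiable_compose[of "\<lambda>(x, y). F x y" "\<lambda>y. (x, y)" y UNIV] assms
  by (auto intro: differentiable_at_withinI)

lemma differentiable_control_form:
  assumes "\<rho> differentiable (at q)" and "induced_metric \<rho> gQ differentiable (at q)"
    and "invertible (induced_metric \<rho> gQ q)"
  shows "control_form \<rho> gQ differentiable (at q)"
proof -
  \<comment> \<open>Stated for rectangular matrices of arbitrary sizes, because the two products in
    \<open>control_form\<close> have different shapes.\<close>
  have prod: "(\<lambda>x. A x ** B x) differentiable (at q)"
    if "A differentiable (at q)" "B differentiable (at q)"
    for A :: "real^'a \<Rightarrow> real^'n^'k" and B :: "real^'a \<Rightarrow> real^'p^'n"
    using that bounded_bilinear.FDERIV[OF bounded_bilinear_matrix_matrix_mult]
    unfolding differentiable_def by blast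
  show ?thesis
    unfolding control_form_def[abs_def]
    by (intro prod differentiable_transpose differentiable_matrix_inv assms)
qed

section \<open>Partial gradients of the Lagrangian and the Hamiltonian\<close>

text \<open>The term \<open>- (w \<bullet> v)\<close> is bilinear and the drift term depends on
  \<open>v\<close> alone. The resulting pair is the momentum of the Legendre transformation.\<close>

lemma GDERIV_lagrangian_velocity:
  fixes f :: "real^'d \<Rightarrow> real^'d \<Rightarrow> real^'d"
  assumes "(\<lambda>v. f q v) differentiable (at v)"
  shows "GDERIV (\<lambda>w. lagrangian f b (q, l) w) (v, w) :>
      (- w - transpose (jacobian (\<lambda>v. f q v) (at v)) *v l, - v)"
  unfolding gderiv_def
proof (rule has_derivative_eq_rhs)
  let ?J = "transpose (jacobian (\<lambda>v. f q v) (at v)) *v l"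
  have l: "((\<lambda>v. l \<bullet> f q v) has_derivative (\<lambda>h. h \<bullet> ?J)) (at v)"
    using GDERIV_inner_const[OF assms, of l] by (simp add: gderiv_def)
  \<comment> \<open>The simp rule \<open>transpose_matrix_vector\<close> would turn
    \<open>transpose A *v x\<close> into \<open>x v* A\<close>; here and in many later steps it is
    removed so that terms keep the shape used in the definitions.\<close>
  have l: "((\<lambda>y. l \<bullet> f q (fst y)) has_derivative (\<lambda>h. fst h \<bullet> ?J)) (at (v, w))"
    by (rule has_derivative_compose[OF has_derivative_fst[OF has_derivative_ident]]) (simp add: l del: transpose_matrix_vector)
  have "((\<lambda>y. - (snd y \<bullet> fst y) - l \<bullet> f q (fst y) - 1/2 * quad (b q) l) has_derivative
      (\<lambda>h. - (w \<bullet> fst h + snd h \<bullet> v) - fst h \<bullet> ?J)) (at (v, w))"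
    by (rule has_derivative_eq_rhs, (rule l has_derivative_diff has_derivative_add has_derivative_minus
        has_derivative_const has_derivative_inner has_derivative_fst has_derivative_snd
        has_derivative_ident)+) auto
  then show "((\<lambda>w. lagrangian f b (q, l) w) has_derivative
      (\<lambda>h. - (w \<bullet> fst h + snd h \<bullet> v) - fst h \<bullet> ?J)) (at (v, w))"
    by (simp add: lagrangian_def case_prod_beta del: transpose_matrix_vector)
  show "(\<lambda>h. - (w \<bullet> fst h + snd h \<bullet> v) - fst h \<bullet> ?J) = (\<lambda>h. h \<bullet> (- w - ?J, - v))"
    by (auto simp: inner_diff_right inner_commute)
qed

text \<open>These are the right-hand sides of Hamilton's first pair of equations. Differentiability
  of \<open>f q\<close> is asked at \<open>- pl\<close> because \<open>tilde f q\<close> is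
  \<open>f q\<close> composed with negation.\<close>

lemma GDERIV_hamiltonian_momentum:
  fixes f :: "real^'d \<Rightarrow> real^'d \<Rightarrow> real^'d"
  assumes "(\<lambda>v. f q v) differentiable (at (- pl))"
  shows "GDERIV (\<lambda>p. hamiltonian f b (q, l) p) (pq, pl) :>
      (- pl, - pq + transpose (jacobian (\<lambda>p. tilde f q p) (at pl)) *v l)"
  unfolding gderiv_def
proof (rule has_derivative_eq_rhs)
  let ?J = "transpose (jacobian (\<lambda>p. tilde f q p) (at pl)) *v l"
  have "(\<lambda>p. tilde f q p) differentiable (at pl)"
    unfolding tilde_def
    using differentiable_compose[of "f q" uminus pl UNIV] assms
    by (auto intro: differentiable_at_withinI)
  then have l: "((\<lambda>p. l \<bullet> tilde f q p) has_derivative (\<lambda>h. h \<bullet> ?J)) (at pl)"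
    using GDERIV_inner_const[of "\<lambda>p. tilde f q p" pl l] by (simp add: gderiv_def)
  have l: "((\<lambda>y. l \<bullet> tilde f q (snd y)) has_derivative (\<lambda>h. snd h \<bullet> ?J)) (at (pq, pl))"
    by (rule has_derivative_compose[OF has_derivative_snd[OF has_derivative_ident]]) (simp add: l del: transpose_matrix_vector)
  have "((\<lambda>y. - (snd y \<bullet> fst y) + l \<bullet> tilde f q (snd y) + 1/2 * quad (b q) l) has_derivative
      (\<lambda>h. - (pl \<bullet> fst h + snd h \<bullet> pq) + snd h \<bullet> ?J)) (at (pq, pl))"
    by (rule has_derivative_eq_rhs, (rule l has_derivative_diff has_derivative_add has_derivative_minus
        has_derivative_const has_derivative_inner has_derivative_fst has_derivative_snd
        has_derivative_ident)+) auto
  then show "((\<lambda>p. hamiltonian f b (q, l) p) has_derivative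
      (\<lambda>h. - (pl \<bullet> fst h + snd h \<bullet> pq) + snd h \<bullet> ?J)) (at (pq, pl))"
    by (simp add: hamiltonian_def case_prod_beta del: transpose_matrix_vector)
  show "(\<lambda>h. - (pl \<bullet> fst h + snd h \<bullet> pq) + snd h \<bullet> ?J) = (\<lambda>h. h \<bullet> (- pl, - pq + ?J))"
    by (auto simp: inner_add_right inner_diff_right inner_commute)
qed

text \<open>The Lagrangian and the Hamiltonian both contain this expression, with opposite signs and
  with \<open>F\<close> the drift at a fixed velocity, so one computation yields both position
  gradients. Symmetry of \<open>b q\<close> merges the two halves of the \<open>l\<close>-derivative
  of \<open>quad\<close> into \<open>b q *v l\<close>.\<close>

lemma GDERIV_pairing_quad:
  fixes F :: "real^'d \<Rightarrow> real^'d" and b :: "real^'d \<Rightarrow> real^'d^'d"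
  assumes F: "F differentiable (at q)" and b: "b differentiable (at q)"
    and sym: "transpose (b q) = b q"
  shows "GDERIV (\<lambda>y. snd y \<bullet> F (fst y) + 1/2 * quad (b (fst y)) (snd y)) (q, l) :>
      (transpose (jacobian F (at q)) *v l + (1/2) *\<^sub>R grad (\<lambda>x. quad (b x) l) q, F q + b q *v l)"
    (is "GDERIV _ _ :> (?J + (1/2) *\<^sub>R ?G, _)")
proof -
  obtain b' where b': "(b has_derivative b') (at q)"
    using b by (auto simp: differentiable_def)
  define F' where "F' = (*v) (jacobian F (at q))"
  have F': "(F has_derivative F') (at q)"
    using F by (simp add: jacobian_works F'_def)
  note mult = bounded_bilinear.FDERIV[OF bounded_bilinear_matrix_vector_mult]
  have fst_F: "((\<lambda>y. F (fst y)) has_derivative (\<lambda>h. F' (fst h))) (at (q, l))"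
    by (rule has_derivative_compose[OF has_derivative_fst[OF has_derivative_ident]]) (simp add: F')
  have fst_b: "((\<lambda>y. b (fst y)) has_derivative (\<lambda>h. b' (fst h))) (at (q, l))"
    by (rule has_derivative_compose[OF has_derivative_fst[OF has_derivative_ident]]) (simp add: b')
  have deriv: "((\<lambda>y. snd y \<bullet> F (fst y) + 1/2 * quad (b (fst y)) (snd y)) has_derivative
      (\<lambda>h. l \<bullet> F' (fst h) + snd h \<bullet> F q +
        1/2 * (l \<bullet> (b q *v snd h + b' (fst h) *v l) + snd h \<bullet> (b q *v l)))) (at (q, l))"
    unfolding quad_def
    by (auto intro!: derivative_eq_intros mult fst_F fst_b)
  have quad': "((\<lambda>x. quad (b x) l) has_derivative (\<lambda>h. l \<bullet> (b' h *v l))) (at q)"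
    unfolding quad_def
    by (auto intro!: derivative_eq_intros mult b')
  \<comment> \<open>Uniqueness of the derivative replaces the unknown derivative \<open>b'\<close>
    by the \<open>grad\<close> term that appears in the equations of motion.\<close>
  then have G: "l \<bullet> (b' h *v l) = h \<bullet> ?G" for h
    using GDERIV_grad has_derivative_unique unfolding gderiv_def
    by (metis (mono_tags, lifting) differentiableI)
  have J: "l \<bullet> F' h = h \<bullet> ?J" for h
    using GDERIV_inner_const[OF F, of l] has_derivative_unique[OF has_derivative_inner_right[OF F']]
    unfolding gderiv_def by metis
  have b_adj: "l \<bullet> (b q *v h) = h \<bullet> (b q *v l)" for h
    by (metis dot_lmul_matrix inner_commute sym transpose_matrix_vector)
  have "(\<lambda>h. l \<bullet> F' (fst h) + snd h \<bullet> F q +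
        1/2 * (l \<bullet> (b q *v snd h + b' (fst h) *v l) + snd h \<bullet> (b q *v l))) =
      (\<lambda>h. h \<bullet> (?J + (1/2) *\<^sub>R ?G, F q + b q *v l))"
    by (auto simp: inner_add_right G J b_adj simp del: transpose_matrix_vector)
  with deriv show ?thesis
    unfolding gderiv_def by (rule has_derivative_eq_rhs)
qed

text \<open>Chain rule with inner map \<open>p \<mapsto> - p\<close>, whose derivative contributes
  the sign.\<close>

lemma jacobian_tilde:
  fixes f :: "real^'d \<Rightarrow> real^'n \<Rightarrow> real^'k"
  assumes "(\<lambda>v. f q v) differentiable (at (- p))"
  shows "jacobian (\<lambda>p. tilde f q p) (at p) = - jacobian (\<lambda>v. f q v) (at (- p))"
proof -
  let ?J = "jacobian (\<lambda>v. f q v) (at (- p))"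
  have "((\<lambda>v. f q v) has_derivative (*v) ?J) (at (- p))"
    using assms by (simp add: jacobian_works)
  then have "((\<lambda>p. tilde f q p) has_derivative (\<lambda>h. ?J *v (- h))) (at p)"
    unfolding tilde_def
    by (intro has_derivative_compose[of uminus uminus p UNIV "f q"]) (auto intro!: derivative_eq_intros)
  moreover have "(\<lambda>h. ?J *v (- h)) = (*v) (- ?J)"
    by (auto simp: matrix_vector_mult_def vec_eq_iff sum_negf)
  ultimately show ?thesis
    unfolding jacobian_def by (metis frechet_derivative_at matrix_of_matrix_vector_mul)
qed

lemma transpose_uminus_mult: "transpose (- A) *v x = - (transpose A *v x)"
  for A :: "real^'n^'k"
  by (simp add: vec_eq_iff matrix_vector_mult_def transpose_def sum_negf del: transpose_matrix_vector)

section \<open>Derivatives of curves on a compact interval\<close>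

lemma has_vector_derivative_Pair_iff:
  "((\<lambda>s. (x s, y s)) has_vector_derivative (a, b)) (at t within S) \<longleftrightarrow>
    (x has_vector_derivative a) (at t within S) \<and> (y has_vector_derivative b) (at t within S)"
proof
  assume "((\<lambda>s. (x s, y s)) has_vector_derivative (a, b)) (at t within S)"
  from bounded_linear.has_vector_derivative[OF bounded_linear_fst this]
    bounded_linear.has_vector_derivative[OF bounded_linear_snd this]
  show "(x has_vector_derivative a) (at t within S) \<and> (y has_vector_derivative b) (at t within S)"
    by simp
qed (simp add: has_vector_derivative_Pair)

text \<open>A derivative within \<open>S\<close> sees a curve only on \<open>S\<close>. The momentum
  formulas are available only at times in the interval, and this is enough to differentiate
  them.\<close>

lemma has_vector_derivative_cong_on:
  assumes "t \<in> S" and "\<And>s. s \<in> S \<Longrightarrow> x s = y s"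
  shows "(x has_vector_derivative d) (at t within S) \<longleftrightarrow> (y has_vector_derivative d) (at t within S)"
  using has_vector_derivative_transform[of t S x y d] has_vector_derivative_transform[of t S y x d] assms
  by auto

text \<open>The condition \<open>a < b\<close> makes the derivative within the interval unique at
  every point, the endpoints included.\<close>

lemma vel_eqI:
  "\<lbrakk>(x has_vector_derivative d) (at t within {a..b}); t \<in> {a..b}; a < b\<rbrakk> \<Longrightarrow> vel {a..b} x t = d"
  unfolding vel_def using vector_derivative_within_cbox[of a b t x d] by simp

text \<open>The derivative hidden in \<open>Ck_curve\<close> is an existential witness, arbitrary
  outside the interval. It agrees with \<open>vel\<close> on the interval, so its own derivative is
  inherited by \<open>vel\<close>.\<close>

lemma Ck_curve_Suc_vel:
  assumes "Ck_curve (Suc (Suc k)) {a..b} x" and "t \<in> {a..b}" and "a < b"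
  shows "(x has_vector_derivative vel {a..b} x t) (at t within {a..b})"
    and "\<exists>D. (vel {a..b} x has_vector_derivative D) (at t within {a..b})"
proof -
  obtain x' x'' where
    x': "\<And>t. t \<in> {a..b} \<Longrightarrow> (x has_vector_derivative x' t) (at t within {a..b})" and
    x'': "\<And>t. t \<in> {a..b} \<Longrightarrow> (x' has_vector_derivative x'' t) (at t within {a..b})"
    using assms(1) unfolding Ck_curve.simps by blast
  have vel: "vel {a..b} x t = x' t" if "t \<in> {a..b}" for t
    using x' that assms(3) by (intro vel_eqI)
  show "(x has_vector_derivative vel {a..b} x t) (at t within {a..b})"
    using x' vel assms(2) by simp
  show "\<exists>D. (vel {a..b} x has_vector_derivative D) (at t within {a..b})"
    using has_vector_derivative_transform[OF assms(2) vel x''[OF assms(2)]] by blast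
qed

text \<open>Regularity is given for the paired curve and is projected to the components. The last
  claim supplies the second derivative of \<open>l\<close>, which later permits splitting the
  derivative of the momentum.\<close>

lemma cotangent_curve_vel:
  assumes "cotangent_curve 3 {a..b} Q q l" and "t \<in> {a..b}" and "a < b"
  shows "q t \<in> Q"
    and "(q has_vector_derivative vel {a..b} q t) (at t within {a..b})"
    and "(l has_vector_derivative vel {a..b} l t) (at t within {a..b})"
    and "vel {a..b} (\<lambda>t. (q t, l t)) t = (vel {a..b} q t, vel {a..b} l t)"
    and "\<exists>D. (vel {a..b} l has_vector_derivative D) (at t within {a..b})"
proof -
  let ?I = "{a..b}" and ?y = "\<lambda>t. (q t, l t)"
  show "q t \<in> Q"
    using assms by (auto simp: cotangent_curve_def)
  have C3: "Ck_curve (Suc (Suc 1)) ?I ?y"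
    using assms(1) by (simp add: cotangent_curve_def numeral_3_eq_3)
  have comps: "(q has_vector_derivative fst (vel ?I ?y t)) (at t within ?I)"
    "(l has_vector_derivative snd (vel ?I ?y t)) (at t within ?I)" if "t \<in> ?I" for t
  proof -
    have "(?y has_vector_derivative (fst (vel ?I ?y t), snd (vel ?I ?y t))) (at t within ?I)"
      using Ck_curve_Suc_vel(1)[OF C3 that assms(3)] by simp
    then show "(q has_vector_derivative fst (vel ?I ?y t)) (at t within ?I)"
      "(l has_vector_derivative snd (vel ?I ?y t)) (at t within ?I)"
      unfolding has_vector_derivative_Pair_iff by auto
  qed
  then have vels: "vel ?I q t = fst (vel ?I ?y t)" "vel ?I l t = snd (vel ?I ?y t)" if "t \<in> ?I" for t
    using vel_eqI[OF comps(1)[OF that] that assms(3)] vel_eqI[OF comps(2)[OF that] that assms(3)]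
    by auto
  show "(q has_vector_derivative vel ?I q t) (at t within ?I)"
    "(l has_vector_derivative vel ?I l t) (at t within ?I)"
    "vel ?I ?y t = (vel ?I q t, vel ?I l t)"
    using comps vels assms(2) by auto
  obtain D where "(vel ?I ?y has_vector_derivative D) (at t within ?I)"
    using Ck_curve_Suc_vel(2)[OF C3 assms(2,3)] by blast
  then have "((\<lambda>s. snd (vel ?I ?y s)) has_vector_derivative snd D) (at t within ?I)"
    by (rule bounded_linear.has_vector_derivative[OF bounded_linear_snd])
  then have "(vel ?I l has_vector_derivative snd D) (at t within ?I)"
    by (rule has_vector_derivative_transform[OF assms(2), rotated]) (rule vels(2))
  then show "\<exists>D. (vel ?I l has_vector_derivative D) (at t within ?I)" ..
qed

section \<open>Legendre transformation and equations of motion in coordinates\<close>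

text \<open>Collects what the gradient computations ask of the drift and of \<open>b\<close>; the
  metric and the control matrix enter through \<open>b\<close>.\<close>

locale control_affine =
  fixes Q :: "(real^'d) set"
    and f :: "real^'d \<Rightarrow> real^'d \<Rightarrow> real^'d"
    and b :: "real^'d \<Rightarrow> real^'d^'d"
  assumes f_vel: "q \<in> Q \<Longrightarrow> (\<lambda>v. f q v) differentiable (at v)"
    and f_pos: "q \<in> Q \<Longrightarrow> (\<lambda>x. f x v) differentiable (at q)"
    and b_diff: "q \<in> Q \<Longrightarrow> b differentiable (at q)"
    and b_sym: "q \<in> Q \<Longrightarrow> transpose (b q) = b q"
begin

lemma legendre_lagrangian:
  assumes "q \<in> Q"
  shows "legendre (lagrangian f b) (q, l) (v, w) =
    (- w - transpose (jacobian (\<lambda>v. f q v) (at v)) *v l, - v)"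
  unfolding legendre_def by (intro grad_eqI GDERIV_lagrangian_velocity f_vel assms)

lemma bij_legendre:
  assumes "q \<in> Q"
  shows "bij (legendre (lagrangian f b) (q, l))"
proof (rule o_bij)
  \<comment> \<open>Solving for the velocities: the second momentum component \<open>r\<close> gives
    \<open>v = - r\<close>, after which the first component \<open>p\<close> is solved for
    \<open>w\<close>.\<close>
  define inv where
    "inv = (\<lambda>(p :: real^'d, r). (- r, - p - transpose (jacobian (\<lambda>v. f q v) (at (- r))) *v l))"
  show "inv \<circ> legendre (lagrangian f b) (q, l) = id"
    by (auto simp: legendre_lagrangian[OF assms] inv_def)
  show "legendre (lagrangian f b) (q, l) \<circ> inv = id"
    by (auto simp: legendre_lagrangian[OF assms] inv_def)
qed

text \<open>At momentum \<open>- v\<close> the function \<open>tilde f\<close> returns to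
  \<open>f q v\<close>. In the pairing of momentum and velocity \<open>w \<bullet> v\<close> occurs
  twice, and one copy cancels against the Lagrangian.\<close>

lemma hamiltonian_legendre:
  assumes "q \<in> Q"
  shows "hamiltonian f b (q, l) (legendre (lagrangian f b) (q, l) (v, w)) =
    legendre (lagrangian f b) (q, l) (v, w) \<bullet> (v, w) - lagrangian f b (q, l) (v, w)"
  unfolding legendre_lagrangian[OF assms]
  by (simp add: hamiltonian_def lagrangian_def tilde_def dot_lmul_matrix
      inner_diff_left inner_diff_right inner_commute)

lemma grad_lagrangian_position:
  assumes "q \<in> Q"
  shows "grad (\<lambda>x. lagrangian f b x (v, w)) (q, l) =
    - (transpose (jacobian (\<lambda>x. f x v) (at q)) *v l + (1/2) *\<^sub>R grad (\<lambda>x. quad (b x) l) q,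
       f q v + b q *v l)"
proof -
  have "(\<lambda>x. lagrangian f b x (v, w)) =
      (\<lambda>x. - (w \<bullet> v) + - (snd x \<bullet> f (fst x) v + 1/2 * quad (b (fst x)) (snd x)))"
    by (auto simp: lagrangian_def)
  \<comment> \<open>The summand \<open>0\<close> is the gradient of the constant
    \<open>- (w \<bullet> v)\<close>; it is kept so that the sum rule applies verbatim.\<close>
  moreover have "GDERIV \<dots> (q, l) :>
      0 + - (transpose (jacobian (\<lambda>x. f x v) (at q)) *v l + (1/2) *\<^sub>R grad (\<lambda>x. quad (b x) l) q,
        f q v + b q *v l)"
    by (intro GDERIV_add GDERIV_const GDERIV_minus GDERIV_pairing_quad f_pos b_diff b_sym assms)
  ultimately show ?thesis
    by (intro grad_eqI) (simp only: add_0)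
qed

lemma grad_hamiltonian_position:
  assumes "q \<in> Q"
  shows "grad (\<lambda>x. hamiltonian f b x (pq, pl)) (q, l) =
    (transpose (jacobian (\<lambda>x. tilde f x pl) (at q)) *v l + (1/2) *\<^sub>R grad (\<lambda>x. quad (b x) l) q,
     tilde f q pl + b q *v l)"
proof -
  have "(\<lambda>x. hamiltonian f b x (pq, pl)) =
      (\<lambda>x. - (pl \<bullet> pq) + (snd x \<bullet> f (fst x) (- pl) + 1/2 * quad (b (fst x)) (snd x)))"
    by (auto simp: hamiltonian_def tilde_def)
  moreover have "GDERIV \<dots> (q, l) :>
      0 + (transpose (jacobian (\<lambda>x. f x (- pl)) (at q)) *v l + (1/2) *\<^sub>R grad (\<lambda>x. quad (b x) l) q,
        f q (- pl) + b q *v l)"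
    by (intro GDERIV_add GDERIV_const GDERIV_pairing_quad f_pos b_diff b_sym assms)
  ultimately show ?thesis
    unfolding tilde_def by (intro grad_eqI) (simp only: add_0)
qed

text \<open>Both sides assert existence of the derivatives, so once the gradients are computed only
  the splitting of pairs remains.\<close>

lemma hamilton_iff_hamilton_system:
  assumes "\<And>t. t \<in> I \<Longrightarrow> q t \<in> Q"
  shows "hamilton (hamiltonian f b) I (\<lambda>t. (q t, l t)) (\<lambda>t. (pq t, pl t)) \<longleftrightarrow>
    hamilton_system f b I q l pq pl"
proof -
  have "grad (\<lambda>w. hamiltonian f b (q t, l t) w) (pq t, pl t) =
      (- pl t, - pq t + transpose (jacobian (\<lambda>p. tilde f (q t) p) (at (pl t))) *v l t)"
    if "t \<in> I" for t
    by (intro grad_eqI GDERIV_hamiltonian_momentum f_vel assms that)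
  then show ?thesis
    unfolding hamilton_def hamilton_system_def
    by (simp add: grad_hamiltonian_position assms has_vector_derivative_Pair_iff conj_ac
        del: transpose_matrix_vector cong: ball_cong)
qed

context
  fixes \<alpha> \<beta> :: real and q l :: "real \<Rightarrow> real^'d"
  assumes less: "\<alpha> < \<beta>" and curve: "cotangent_curve 3 {\<alpha>..\<beta>} Q q l"
begin

lemmas curve_vel = cotangent_curve_vel[OF curve _ less]

text \<open>Along the curve the momentum is \<open>(- vel l - ?P, - vel q)\<close> and the position
  gradient is \<open>- (?A, ?B)\<close>. The second component is the equation for \<open>q\<close>;
  the first gives the equation for \<open>l\<close> once the derivative of the sum is split.\<close>

lemma euler_lagrange_iff_system:
  "euler_lagrange (lagrangian f b) {\<alpha>..\<beta>} (\<lambda>t. (q t, l t)) \<longleftrightarrow> euler_lagrange_system f b {\<alpha>..\<beta>} q l"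
proof -
  let ?P = "\<lambda>s. transpose (jacobian (\<lambda>v. f (q s) v) (at (vel {\<alpha>..\<beta>} q s))) *v l s"
  let ?A = "\<lambda>t. transpose (jacobian (\<lambda>x. f x (vel {\<alpha>..\<beta>} q t)) (at (q t))) *v l t
    + (1/2) *\<^sub>R grad (\<lambda>x. quad (b x) (l t)) (q t)"
  let ?B = "\<lambda>t. f (q t) (vel {\<alpha>..\<beta>} q t) + b (q t) *v l t"
  have mom: "grad (\<lambda>w. lagrangian f b (q s, l s) w) (vel {\<alpha>..\<beta>} (\<lambda>t. (q t, l t)) s) =
      (- vel {\<alpha>..\<beta>} l s - ?P s, - vel {\<alpha>..\<beta>} q s)" if "s \<in> {\<alpha>..\<beta>}" for s
    unfolding curve_vel(4)[OF that]
    by (intro grad_eqI GDERIV_lagrangian_velocity f_vel curve_vel(1) that)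
  have "((\<lambda>s. grad (\<lambda>w. lagrangian f b (q s, l s) w) (vel {\<alpha>..\<beta>} (\<lambda>t. (q t, l t)) s))
        has_vector_derivative
        grad (\<lambda>x. lagrangian f b x (vel {\<alpha>..\<beta>} (\<lambda>t. (q t, l t)) t)) (q t, l t)) (at t within {\<alpha>..\<beta>}) \<longleftrightarrow>
      ((\<lambda>s. (- vel {\<alpha>..\<beta>} l s - ?P s, - vel {\<alpha>..\<beta>} q s)) has_vector_derivative - (?A t, ?B t)) (at t within {\<alpha>..\<beta>})"
    if t: "t \<in> {\<alpha>..\<beta>}" for t
    unfolding curve_vel(4)[OF t] grad_lagrangian_position[OF curve_vel(1)[OF t]]
    by (rule has_vector_derivative_cong_on[OF t]) (rule mom)
  moreover have "((\<lambda>s. (- vel {\<alpha>..\<beta>} l s - ?P s, - vel {\<alpha>..\<beta>} q s)) has_vector_derivative - (?A t, ?B t))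
        (at t within {\<alpha>..\<beta>}) \<longleftrightarrow>
      (vel {\<alpha>..\<beta>} q has_vector_derivative ?B t) (at t within {\<alpha>..\<beta>}) \<and>
      (\<exists>D. (?P has_vector_derivative D) (at t within {\<alpha>..\<beta>}) \<and>
        (vel {\<alpha>..\<beta>} l has_vector_derivative (1/2) *\<^sub>R grad (\<lambda>x. quad (b x) (l t)) (q t)
          + transpose (jacobian (\<lambda>x. f x (vel {\<alpha>..\<beta>} q t)) (at (q t))) *v l t - D) (at t within {\<alpha>..\<beta>}))"
    (is "_ \<longleftrightarrow> _ \<and> (\<exists>D. ?M D \<and> ?L D)") if t: "t \<in> {\<alpha>..\<beta>}" for t
  proof -
    have "((\<lambda>s. - vel {\<alpha>..\<beta>} q s) has_vector_derivative - ?B t) (at t within {\<alpha>..\<beta>}) \<longleftrightarrow>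
        (vel {\<alpha>..\<beta>} q has_vector_derivative ?B t) (at t within {\<alpha>..\<beta>})"
      using has_vector_derivative_minus[of "vel {\<alpha>..\<beta>} q"] has_vector_derivative_minus[of "\<lambda>s. - vel {\<alpha>..\<beta>} q s"]
      by fastforce
    moreover have "((\<lambda>s. - vel {\<alpha>..\<beta>} l s - ?P s) has_vector_derivative - ?A t) (at t within {\<alpha>..\<beta>}) \<longleftrightarrow>
        (\<exists>D. ?M D \<and> ?L D)"
    proof
      assume h: "((\<lambda>s. - vel {\<alpha>..\<beta>} l s - ?P s) has_vector_derivative - ?A t) (at t within {\<alpha>..\<beta>})"
      obtain l'' where l'': "(vel {\<alpha>..\<beta>} l has_vector_derivative l'') (at t within {\<alpha>..\<beta>})"
        using curve_vel(5)[OF t] by blast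
      \<comment> \<open>Since the second derivative \<open>l''\<close> exists, \<open>?P\<close> is
        the difference of two differentiable functions; its derivative is the witness
        \<open>D\<close>.\<close>
      have "?M (?A t - l'')"
        using has_vector_derivative_diff[OF has_vector_derivative_minus[OF h] l'']
        by (simp add: add.commute del: transpose_matrix_vector)
      with l'' show "\<exists>D. ?M D \<and> ?L D"
        by (intro exI[of _ "?A t - l''"]) (simp add: add.commute del: transpose_matrix_vector)
    next
      assume "\<exists>D. ?M D \<and> ?L D"
      then obtain D where "?M D" "?L D" by blast
      from has_vector_derivative_diff[OF has_vector_derivative_minus[OF this(2)] this(1)]
      show "((\<lambda>s. - vel {\<alpha>..\<beta>} l s - ?P s) has_vector_derivative - ?A t) (at t within {\<alpha>..\<beta>})"
        by (simp add: algebra_simps del: transpose_matrix_vector)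
    qed
    ultimately show ?thesis
      by (simp add: has_vector_derivative_Pair_iff conj_commute del: transpose_matrix_vector)
  qed
  moreover have "((\<lambda>t. (q t, l t)) has_vector_derivative vel {\<alpha>..\<beta>} (\<lambda>t. (q t, l t)) t) (at t within {\<alpha>..\<beta>})"
    if "t \<in> {\<alpha>..\<beta>}" for t
    using curve_vel[OF that] by (simp add: has_vector_derivative_Pair_iff)
  ultimately show ?thesis
    unfolding euler_lagrange_def euler_lagrange_system_def
    by (intro ball_cong refl) (simp only: curve_vel(2,3) simp_thms)
qed

text \<open>The first pair of equations, solved for \<open>pq\<close> and \<open>pl\<close>, is
  exactly the Legendre formula. Substituting it turns the second pair into the Euler-Lagrange
  system.\<close>

lemma hamilton_system_iff:
  "hamilton_system f b {\<alpha>..\<beta>} q l pq pl \<longleftrightarrow>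
    euler_lagrange_system f b {\<alpha>..\<beta>} q l \<and>
    (\<forall>t\<in>{\<alpha>..\<beta>}. pq t = - vel {\<alpha>..\<beta>} l t - transpose (jacobian (\<lambda>v. f (q t) v) (at (vel {\<alpha>..\<beta>} q t))) *v l t \<and> pl t = - vel {\<alpha>..\<beta>} q t)"
proof -
  let ?P = "\<lambda>s. transpose (jacobian (\<lambda>v. f (q s) v) (at (vel {\<alpha>..\<beta>} q s))) *v l s"
  let ?A = "\<lambda>t. transpose (jacobian (\<lambda>x. f x (vel {\<alpha>..\<beta>} q t)) (at (q t))) *v l t
    + (1/2) *\<^sub>R grad (\<lambda>x. quad (b x) (l t)) (q t)"
  let ?B = "\<lambda>t. f (q t) (vel {\<alpha>..\<beta>} q t) + b (q t) *v l t"
  \<comment> \<open>The sign from \<open>jacobian_tilde\<close> is what makes the equation for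
    \<open>l\<close> agree with the formula for \<open>pq\<close>.\<close>
  have J: "transpose (jacobian (\<lambda>p. tilde f (q t) p) (at (pl t))) *v l t = - ?P t"
    if "t \<in> {\<alpha>..\<beta>}" "pl t = - vel {\<alpha>..\<beta>} q t" for t
    using jacobian_tilde[of f "q t" "pl t"] f_vel[OF curve_vel(1)[OF that(1)]] that(2)
    by (simp add: transpose_uminus_mult del: transpose_matrix_vector)
  show ?thesis
  proof
    assume "hamilton_system f b {\<alpha>..\<beta>} q l pq pl"
    then have h: "(q has_vector_derivative - pl t) (at t within {\<alpha>..\<beta>})"
      "(l has_vector_derivative - pq t + transpose (jacobian (\<lambda>p. tilde f (q t) p) (at (pl t))) *v l t)
        (at t within {\<alpha>..\<beta>})"
      "(pq has_vector_derivative
           - (transpose (jacobian (\<lambda>x. tilde f x (pl t)) (at (q t))) *v l t)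
           - (1/2) *\<^sub>R grad (\<lambda>x. quad (b x) (l t)) (q t)) (at t within {\<alpha>..\<beta>})"
      "(pl has_vector_derivative - tilde f (q t) (pl t) - b (q t) *v l t) (at t within {\<alpha>..\<beta>})"
      if "t \<in> {\<alpha>..\<beta>}" for t
      using that by (auto simp: hamilton_system_def simp del: transpose_matrix_vector)
    have pl: "pl t = - vel {\<alpha>..\<beta>} q t" if "t \<in> {\<alpha>..\<beta>}" for t
      using vel_eqI[OF h(1)] that less by simp
    have pq: "pq t = - vel {\<alpha>..\<beta>} l t - ?P t" if "t \<in> {\<alpha>..\<beta>}" for t
      using vel_eqI[OF h(2)] that less J[OF that pl[OF that]] by (simp del: transpose_matrix_vector)
    have "(vel {\<alpha>..\<beta>} q has_vector_derivative ?B t) (at t within {\<alpha>..\<beta>})" if t: "t \<in> {\<alpha>..\<beta>}" for t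
    proof -
      have "((\<lambda>s. - pl s) has_vector_derivative ?B t) (at t within {\<alpha>..\<beta>})"
        using has_vector_derivative_minus[OF h(4)[OF t]] pl[OF t] by (simp add: tilde_def add.commute)
      then show ?thesis
        by (rule has_vector_derivative_transform[OF t, rotated]) (simp add: pl)
    qed
    moreover have "\<exists>D. (?P has_vector_derivative D) (at t within {\<alpha>..\<beta>}) \<and>
        (vel {\<alpha>..\<beta>} l has_vector_derivative (1/2) *\<^sub>R grad (\<lambda>x. quad (b x) (l t)) (q t)
          + transpose (jacobian (\<lambda>x. f x (vel {\<alpha>..\<beta>} q t)) (at (q t))) *v l t - D) (at t within {\<alpha>..\<beta>})"
      if t: "t \<in> {\<alpha>..\<beta>}" for t
    proof -
      obtain l'' where l'': "(vel {\<alpha>..\<beta>} l has_vector_derivative l'') (at t within {\<alpha>..\<beta>})"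
        using curve_vel(5)[OF t] by blast
      \<comment> \<open>On the interval this function equals \<open>?P\<close>, so the equation for
        \<open>pq\<close> together with \<open>l''\<close> yields the required derivative of
        \<open>?P\<close>.\<close>
      have "((\<lambda>s. - pq s - vel {\<alpha>..\<beta>} l s) has_vector_derivative ?A t - l'') (at t within {\<alpha>..\<beta>})"
        using has_vector_derivative_diff[OF has_vector_derivative_minus[OF h(3)[OF t]] l''] pl[OF t]
        by (simp add: tilde_def add.commute del: transpose_matrix_vector)
      then have "(?P has_vector_derivative ?A t - l'') (at t within {\<alpha>..\<beta>})"
        by (rule has_vector_derivative_transform[OF t, rotated]) (simp add: pq)
      with l'' show ?thesis
        by (intro exI[of _ "?A t - l''"]) (simp add: add.commute del: transpose_matrix_vector)
    qed
    ultimately show "euler_lagrange_system f b {\<alpha>..\<beta>} q l \<and>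
        (\<forall>t\<in>{\<alpha>..\<beta>}. pq t = - vel {\<alpha>..\<beta>} l t - ?P t \<and> pl t = - vel {\<alpha>..\<beta>} q t)"
      using curve_vel(2,3) pl pq unfolding euler_lagrange_system_def by blast
  next
    assume "euler_lagrange_system f b {\<alpha>..\<beta>} q l \<and>
      (\<forall>t\<in>{\<alpha>..\<beta>}. pq t = - vel {\<alpha>..\<beta>} l t - ?P t \<and> pl t = - vel {\<alpha>..\<beta>} q t)"
    then have el: "euler_lagrange_system f b {\<alpha>..\<beta>} q l"
      and pq: "\<And>t. t \<in> {\<alpha>..\<beta>} \<Longrightarrow> pq t = - vel {\<alpha>..\<beta>} l t - ?P t"
      and pl: "\<And>t. t \<in> {\<alpha>..\<beta>} \<Longrightarrow> pl t = - vel {\<alpha>..\<beta>} q t"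
      by blast+
    have "(q has_vector_derivative - pl t) (at t within {\<alpha>..\<beta>}) \<and>
        (l has_vector_derivative
           - pq t + transpose (jacobian (\<lambda>p. tilde f (q t) p) (at (pl t))) *v l t) (at t within {\<alpha>..\<beta>}) \<and>
        (pq has_vector_derivative
           - (transpose (jacobian (\<lambda>x. tilde f x (pl t)) (at (q t))) *v l t)
           - (1/2) *\<^sub>R grad (\<lambda>x. quad (b x) (l t)) (q t)) (at t within {\<alpha>..\<beta>}) \<and>
        (pl has_vector_derivative - tilde f (q t) (pl t) - b (q t) *v l t) (at t within {\<alpha>..\<beta>})"
      if t: "t \<in> {\<alpha>..\<beta>}" for t
    proof -
      obtain D where D: "(?P has_vector_derivative D) (at t within {\<alpha>..\<beta>})"
          "(vel {\<alpha>..\<beta>} l has_vector_derivative (1/2) *\<^sub>R grad (\<lambda>x. quad (b x) (l t)) (q t)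
            + transpose (jacobian (\<lambda>x. f x (vel {\<alpha>..\<beta>} q t)) (at (q t))) *v l t - D) (at t within {\<alpha>..\<beta>})"
        and q'': "(vel {\<alpha>..\<beta>} q has_vector_derivative ?B t) (at t within {\<alpha>..\<beta>})"
        using el t unfolding euler_lagrange_system_def by blast
      \<comment> \<open>The unknown derivative \<open>D\<close> of \<open>?P\<close> cancels in the
        sum, leaving the equation for \<open>pq\<close>.\<close>
      have "((\<lambda>s. - vel {\<alpha>..\<beta>} l s - ?P s) has_vector_derivative - ?A t) (at t within {\<alpha>..\<beta>})"
        using has_vector_derivative_diff[OF has_vector_derivative_minus[OF D(2)] D(1)]
        by (simp add: algebra_simps del: transpose_matrix_vector)
      then have "(pq has_vector_derivative - ?A t) (at t within {\<alpha>..\<beta>})"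
        by (rule has_vector_derivative_transform[OF t, rotated]) (rule pq)
      moreover have "(pl has_vector_derivative - ?B t) (at t within {\<alpha>..\<beta>})"
        using has_vector_derivative_minus[OF q'']
        by (rule has_vector_derivative_transform[OF t, rotated]) (rule pl)
      ultimately show ?thesis
        using curve_vel(2,3)[OF t] pl[OF t] pq[OF t] J[OF t pl[OF t]]
        by (simp add: tilde_def del: transpose_matrix_vector)
    qed
    then show "hamilton_system f b {\<alpha>..\<beta>} q l pq pl"
      unfolding hamilton_system_def by blast
  qed
qed

text \<open>Hamilton's first pair read as velocity identities at a single time; at the two endpoints
  they are the boundary conditions on the velocities.\<close>

lemma hamilton_vel:
  assumes "hamilton (hamiltonian f b) {\<alpha>..\<beta>} (\<lambda>t. (q t, l t)) (\<lambda>t. (pq t, pl t))"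
    and t: "t \<in> {\<alpha>..\<beta>}"
  shows "vel {\<alpha>..\<beta>} q t = - pl t"
    and "vel {\<alpha>..\<beta>} l t = - pq t + transpose (jacobian (\<lambda>p. tilde f (q t) p) (at (pl t))) *v l t"
proof -
  have "hamilton_system f b {\<alpha>..\<beta>} q l pq pl"
    using assms hamilton_iff_hamilton_system curve_vel(1) by blast
  then have "(q has_vector_derivative - pl t) (at t within {\<alpha>..\<beta>})"
    "(l has_vector_derivative - pq t + transpose (jacobian (\<lambda>p. tilde f (q t) p) (at (pl t))) *v l t)
      (at t within {\<alpha>..\<beta>})"
    using t unfolding hamilton_system_def by blast+
  then show "vel {\<alpha>..\<beta>} q t = - pl t"
    "vel {\<alpha>..\<beta>} l t = - pq t + transpose (jacobian (\<lambda>p. tilde f (q t) p) (at (pl t))) *v l t"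
    by (auto intro: vel_eqI t less)
qed

lemma hamilton_iff_euler_lagrange_system:
  "hamilton (hamiltonian f b) {\<alpha>..\<beta>} (\<lambda>t. (q t, l t)) (\<lambda>t. (pq t, pl t)) \<longleftrightarrow>
    euler_lagrange_system f b {\<alpha>..\<beta>} q l \<and>
    (\<forall>t\<in>{\<alpha>..\<beta>}. pq t = - vel {\<alpha>..\<beta>} l t - transpose (jacobian (\<lambda>v. f (q t) v) (at (vel {\<alpha>..\<beta>} q t))) *v l t \<and> pl t = - vel {\<alpha>..\<beta>} q t)"
  using hamilton_iff_hamilton_system curve_vel(1) hamilton_system_iff by blast

end

end

section \<open>Terminal cost and assembly of the theorem\<close>

text \<open>Chain rule with negation; it removes the minus sign when the terminal condition on
  \<open>l\<close> is expressed through \<open>tilde \<phi>\<close>.\<close>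

lemma grad_uminus_compose:
  fixes h :: "'a::euclidean_space \<Rightarrow> real"
  assumes "h differentiable (at (- x))"
  shows "grad (\<lambda>p. h (- p)) x = - grad h (- x)"
proof (rule grad_eqI)
  have "((\<lambda>p. h (- p)) has_derivative (\<lambda>k. (- k) \<bullet> grad h (- x))) (at x)"
    using GDERIV_grad[OF assms] unfolding gderiv_def
    by (intro has_derivative_compose[of uminus uminus x UNIV h]) (auto intro!: derivative_eq_intros)
  then show "GDERIV (\<lambda>p. h (- p)) x :> - grad h (- x)"
    by (simp add: gderiv_def)
qed

theorem theorem3p9:
  fixes T :: real
    and Q :: "(real^'d) set"
    and f :: "real^'d \<Rightarrow> real^'d \<Rightarrow> real^'d"
    and \<rho> :: "real^'d \<Rightarrow> real^'m^'d"
    and gQ :: "real^'d \<Rightarrow> real^'d^'d"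
    and \<phi> :: "real^'d \<Rightarrow> real^'d \<Rightarrow> real"
    and b :: "real^'d \<Rightarrow> real^'d^'d"
    and L H :: "(real^'d) \<times> (real^'d) \<Rightarrow> (real^'d) \<times> (real^'d) \<Rightarrow> real"
    and I :: "real set"
  assumes "T > 0"
    and "open Q"
    and "CARD('m) \<le> CARD('d)"
    and "\<And>q. q \<in> Q \<Longrightarrow> inj (\<lambda>u. \<rho> q *v u)"
    and "metric_on Q gQ"
    and "C1_on (Q \<times> UNIV) (\<lambda>(q, v). f q v)"
    and "C1_on Q \<rho>"
    and "C1_on Q (induced_metric \<rho> gQ)"
    and "C1_on (Q \<times> UNIV) (\<lambda>(q, v). \<phi> q v)"
    and b_eq: "b = control_form \<rho> gQ"
    and L_eq: "L = lagrangian f b"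
    and H_eq: "H = hamiltonian f b"
    and I_eq: "I = {0..T}"
  shows
    "(\<forall>q\<in>Q. \<forall>l.
        (\<forall>v w. legendre L (q, l) (v, w) = (- w - transpose (jacobian (\<lambda>v. f q v) (at v)) *v l, - v))
      \<and> bij (legendre L (q, l))
      \<and> (\<forall>v w. H (q, l) (legendre L (q, l) (v, w))
                = legendre L (q, l) (v, w) \<bullet> (v, w) - L (q, l) (v, w)))
   \<and> (\<forall>q l pq pl. (\<forall>t\<in>I. q t \<in> Q) \<longrightarrow>
        (hamilton H I (\<lambda>t. (q t, l t)) (\<lambda>t. (pq t, pl t)) \<longleftrightarrow> hamilton_system f b I q l pq pl))
   \<and> (\<forall>q l. cotangent_curve 3 I Q q l \<longrightarrow>
        (euler_lagrange L I (\<lambda>t. (q t, l t)) \<longleftrightarrow> euler_lagrange_system f b I q l)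
      \<and> (euler_lagrange_system f b I q l \<longleftrightarrow>
           (\<exists>pq pl. hamilton H I (\<lambda>t. (q t, l t)) (\<lambda>t. (pq t, pl t))))
      \<and> (\<forall>pq pl. hamilton H I (\<lambda>t. (q t, l t)) (\<lambda>t. (pq t, pl t)) \<longrightarrow>
           (\<forall>t\<in>I. pq t = - vel I l t - transpose (jacobian (\<lambda>v. f (q t) v) (at (vel I q t))) *v l t
              \<and> pl t = - vel I q t)
         \<and> (vel I l T + transpose (jacobian (\<lambda>v. f (q T) v) (at (vel I q T))) *v l T
                = grad (\<lambda>x. \<phi> x (vel I q T)) (q T)
            \<and> l T = - grad (\<lambda>v. \<phi> (q T) v) (vel I q T) \<longrightarrow>
              vel I q 0 = - pl 0
            \<and> vel I l 0 = - pq 0 + transpose (jacobian (\<lambda>p. tilde f (q 0) p) (at (pl 0))) *v l 0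
            \<and> vel I q T = - pl T
            \<and> vel I l T = - pq T + transpose (jacobian (\<lambda>p. tilde f (q T) p) (at (pl T))) *v l T
            \<and> pq T = - grad (\<lambda>x. tilde \<phi> x (pl T)) (q T)
            \<and> l T = grad (\<lambda>p. tilde \<phi> (q T) p) (pl T))))"
proof -
  interpret control_affine Q f b
  proof
    fix q v assume q: "q \<in> Q"
    have f: "(\<lambda>(q, v). f q v) differentiable (at (q, v))"
      using assms(6) q by (auto intro: C1_on_differentiable)
    show "(\<lambda>v. f q v) differentiable (at v)" "(\<lambda>x. f x v) differentiable (at q)"
      using f by (rule differentiable_section_right differentiable_section_left)+
    \<comment> \<open>Invertibility is the link from the assumptions on \<open>\<rho>\<close> and
      \<open>gQ\<close> to both properties of \<open>b\<close>: it is needed to differentiate the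
      inverse and to transpose it.\<close>
    have inv: "invertible (induced_metric \<rho> gQ q)"
      using assms(4,5) q by (intro invertible_induced_metric) (auto simp: metric_on_def)
    then show "b differentiable (at q)"
      unfolding b_eq using assms(7,8) q by (intro differentiable_control_form C1_on_differentiable)
    show "transpose (b q) = b q"
      unfolding b_eq using assms(5) q inv by (intro control_form_symmetric) (auto simp: metric_on_def)
  qed
  have bounds: "0 \<in> {0..T}" "T \<in> {0..T}"
    using \<open>T > 0\<close> by auto
  show ?thesis
    unfolding L_eq H_eq I_eq
  proof (intro conjI allI ballI impI, goal_cases)
    case (1 q l v w)
    then show ?case by (rule legendre_lagrangian)
  next
    case (2 q l)
    then show ?case by (rule bij_legendre)
  next
    case (3 q l v w)
    then show ?case by (rule hamiltonian_legendre)
  next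
    case (4 q l pq pl)
    then show ?case by (intro hamilton_iff_hamilton_system) auto
  next
    case (5 q l)
    then show ?case by (intro euler_lagrange_iff_system \<open>T > 0\<close>)
  next
    case (6 q l)
    show ?case
      unfolding hamilton_iff_euler_lagrange_system[OF \<open>T > 0\<close> 6]
      \<comment> \<open>The existential momenta stay schematic until the two reflexivity steps
        instantiate them with the Legendre formulas.\<close>
      by (rule iffI, intro exI conjI ballI, assumption, rule refl, rule refl, elim exE conjE)
  next
    case (7 q l pq pl t)
    then show ?case
      using hamilton_iff_euler_lagrange_system[OF \<open>T > 0\<close> 7(1)] by blast
  next
    case (8 q l pq pl t)
    then show ?case
      using hamilton_iff_euler_lagrange_system[OF \<open>T > 0\<close> 8(1)] by blast
  next
    case (9 q l pq pl)
    show ?case by (rule hamilton_vel(1)[OF \<open>T > 0\<close> 9(1,2) bounds(1)])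
  next
    case (10 q l pq pl)
    show ?case by (rule hamilton_vel(2)[OF \<open>T > 0\<close> 10(1,2) bounds(1)])
  next
    case (11 q l pq pl)
    show ?case by (rule hamilton_vel(1)[OF \<open>T > 0\<close> 11(1,2) bounds(2)])
  next
    case (12 q l pq pl)
    show ?case by (rule hamilton_vel(2)[OF \<open>T > 0\<close> 12(1,2) bounds(2)])
  next
    case (13 q l pq pl)
    have vel: "vel {0..T} q T = - pl T"
      by (rule hamilton_vel(1)[OF \<open>T > 0\<close> 13(1,2) bounds(2)])
    have "pq T = - vel {0..T} l T
        - transpose (jacobian (\<lambda>v. f (q T) v) (at (vel {0..T} q T))) *v l T"
      using hamilton_iff_euler_lagrange_system[OF \<open>T > 0\<close> 13(1)] 13(2) bounds(2) by blast
    \<comment> \<open>Up to sign, \<open>pq T\<close> is the left-hand side of the first terminal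
      condition.\<close>
    then have "pq T = - (vel {0..T} l T
        + transpose (jacobian (\<lambda>v. f (q T) v) (at (vel {0..T} q T))) *v l T)"
      by (simp del: transpose_matrix_vector)
    also have "\<dots> = - grad (\<lambda>x. \<phi> x (vel {0..T} q T)) (q T)"
      by (rule arg_cong[OF conjunct1[OF 13(3)], where f = uminus])
    \<comment> \<open>The gradient is taken in \<open>x\<close> with the velocity fixed, so
      replacing the velocity by \<open>- pl T\<close> already gives \<open>tilde \<phi>\<close>,
      with no sign from the chain rule.\<close>
    finally show ?case
      unfolding tilde_def vel .
  next
    case (14 q l pq pl)
    have vel: "vel {0..T} q T = - pl T"
      by (rule hamilton_vel(1)[OF \<open>T > 0\<close> 14(1,2) bounds(2)])
    have "(\<lambda>v. \<phi> (q T) v) differentiable (at (- pl T))"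
      using cotangent_curve_vel(1)[OF 14(1) bounds(2) \<open>T > 0\<close>]
      by (intro differentiable_section_right[where F = \<phi> and x = "q T"]
          C1_on_differentiable[OF assms(9)]) simp
    \<comment> \<open>Here the gradient is in the reflected variable: the sign from the chain rule
      yields exactly the minus sign of the second terminal condition.\<close>
    then show ?case
      using conjunct2[OF 14(3)] unfolding tilde_def vel
      by (subst grad_uminus_compose[where h = "\<phi> (q T)"])
  qed
qed

end
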